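(* Let $G$ be a group with neutral element $e$ and let $\mathcal{R} = \bigoplus_{g\in G} \mathcal{R}_g$ be a strongly $G$-graded ring such that $\mathcal{R}_e$ is maximal commutative in $\mathcal{R}$. If $\mathcal{R}_e$ is a simple ring, then $\mathcal{R}$ is a simple ring.
   Context: All rings are associative and unital; $G$ is an arbitrary group. A ring $\mathcal{R}$ is $G$-graded if $\mathcal{R}=\bigoplus_{g\in G}\mathcal{R}_g$ for additive subgroups $\mathcal{R}_g$ with $\mathcal{R}_g\mathcal{R}_h\subseteq \mathcal{R}_{gh}$ for all $g,h\in G$; it is strongly $G$-graded if moreover $\mathcal{R}_g\mathcal{R}_h=\mathcal{R}_{gh}$ for all $g,h\in G$, where $\mathcal{R}_g\mathcal{R}_h$ is the set of all finite sums of products $r_gr_h$ with $r_g\in\mathcal{R}_g$, $r_h\in\mathcal{R}_h$. The subring $\mathcal{R}_e$ (which contains $1_{\mathcal{R}}$) is called the neutral component. For a subset $S\subseteq \mathcal{R}$, the commutant $C_{\mathcal{R}}(S)$ is the set of elements of $\mathcal{R}$ commuting with every element of $S$. A commutative subring $S$ of $\mathcal{R}$ is maximal commutative in $\mathcal{R}$ if $C_{\mathcal{R}}(S)=S$. Ideals are two-sided; a ring is simple if it has no ideals other than $\{0\}$ and itself. *)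

theory Defs
  imports "HOL-Algebra.Algebra"
begin

text \<open>
  The direct sum is internal: every element has a unique finitely supported decomposition into
  homogeneous parts. Families are taken in \<open>\<Pi>\<^sub>E\<close> so that uniqueness is not affected by
  values outside the carrier of \<open>G\<close>, and the sum runs over the support because \<open>finsum\<close> over
  an infinite index set is degenerate.
\<close>

locale graded_ring = G: group G + R: ring R
  for G :: "('g, 'm) monoid_scheme" and R :: "('r, 'n) ring_scheme" +
  fixes comp :: "'g \<Rightarrow> 'r set"
  assumes comp_additive_subgroup:
      "g \<in> carrier G \<Longrightarrow> additive_subgroup (comp g) R"
    and direct_sum:
      "r \<in> carrier R \<Longrightarrow>
        \<exists>!f. f \<in> (\<Pi>\<^sub>E g\<in>carrier G. comp g) \<and> finite {g \<in> carrier G. f g \<noteq> \<zero>\<^bsub>R\<^esub>} \<and>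
             r = finsum R f {g \<in> carrier G. f g \<noteq> \<zero>\<^bsub>R\<^esub>}"
    and comp_mult:
      "\<lbrakk>g \<in> carrier G; h \<in> carrier G; x \<in> comp g; y \<in> comp h\<rbrakk>
        \<Longrightarrow> x \<otimes>\<^bsub>R\<^esub> y \<in> comp (g \<otimes>\<^bsub>G\<^esub> h)"

text \<open>
  \<open>ideal_prod R A B\<close> is defined for arbitrary sets \<open>A\<close>, \<open>B\<close> and consists of all nonempty finite
  sums of products \<open>a \<otimes> b\<close>. As each component contains \<open>\<zero>\<close>, the empty sum is included.
\<close>

locale strongly_graded_ring = graded_ring +
  assumes strong:
    "\<lbrakk>g \<in> carrier G; h \<in> carrier G\<rbrakk>
      \<Longrightarrow> ideal_prod R (comp g) (comp h) = comp (g \<otimes>\<^bsub>G\<^esub> h)"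

definition commutant :: "('r, 'n) ring_scheme \<Rightarrow> 'r set \<Rightarrow> 'r set"
  where "commutant R S = {r \<in> carrier R. \<forall>s\<in>S. r \<otimes>\<^bsub>R\<^esub> s = s \<otimes>\<^bsub>R\<^esub> r}"

definition maximal_commutative :: "('r, 'n) ring_scheme \<Rightarrow> 'r set \<Rightarrow> bool"
  where "maximal_commutative R S \<longleftrightarrow> subcring S R \<and> commutant R S = S"

text \<open>The zero ring counts as simple under this convention.\<close>

locale simple_ring = ring R for R (structure) +
  assumes ideal_trivial: "ideal I R \<Longrightarrow> I = {\<zero>} \<or> I = carrier R"

end

theory Submission
  imports Defs
begin

text \<open>
  Every nonzero ideal \<open>I\<close> of \<open>R\<close> meets the neutral component \<open>R\<^sub>e\<close> nontrivially
  (\<open>nonzero_ideal_meets_neutral\<close>). Choose a nonzero \<open>x\<close> in \<open>I\<close> that is a sum of as few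
  homogeneous terms as possible. By strong grading, \<open>1\<close> is a sum of products from
  \<open>R\<^bsub>h\<inverse>\<^esub> R\<^sub>h\<close> for each \<open>h\<close>, so no nonzero element is annihilated by all of \<open>R\<^sub>h\<close>
  (\<open>exists_homogeneous_nonannihilator\<close>); multiplying \<open>x\<close> by a suitable homogeneous element
  makes one of its terms neutral and keeps it nonzero, without lengthening the sum. For
  \<open>a \<in> R\<^sub>e\<close> the commutator \<open>a x - x a\<close> lies in \<open>I\<close> and has fewer terms, because \<open>R\<^sub>e\<close> is
  commutative and so the neutral term cancels (\<open>commutator_drops_neutral\<close>). By minimality the
  commutator vanishes, so \<open>x\<close> commutes with \<open>R\<^sub>e\<close>, and maximal commutativity puts \<open>x\<close>
  in \<open>R\<^sub>e\<close>.

  If \<open>R\<^sub>e\<close> is simple, the nonzero ideal \<open>I \<inter> R\<^sub>e\<close> of \<open>R\<^sub>e\<close> is all of \<open>R\<^sub>e\<close>, hence contains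
  \<open>1\<close>, and \<open>I = R\<close>.
\<close>

lemma (in ring) ideal_Int_subring:
  assumes "ideal I R" and S: "subring S R"
  shows "ideal (I \<inter> S) (R\<lparr>carrier := S\<rparr>)"
proof -
  have "id \<in> ring_hom (R\<lparr>carrier := S\<rparr>) R"
    using subringE(1)[OF S] by (auto simp: ring_hom_def)
  then have "ring_hom_ring (R\<lparr>carrier := S\<rparr>) R id"
    using subring_is_ring[OF S] ring_axioms
    by (simp add: ring_hom_ring_def ring_hom_ring_axioms_def)
  from ring_hom_ring.ideal_vimage[OF this assms(1)] show ?thesis
    by (simp add: Int_def conj_commute)
qed

context graded_ring
begin

lemma comp_in_carrier: "\<lbrakk>g \<in> carrier G; x \<in> comp g\<rbrakk> \<Longrightarrow> x \<in> carrier R"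
  by (rule additive_subgroup.a_Hcarr[OF comp_additive_subgroup])

text \<open>
  Terms may vanish, so \<open>card F\<close> only bounds the number of nonzero homogeneous parts. This bound
  suffices as the length to be minimized, and multiplication by a homogeneous element, which may
  annihilate some of the parts, then simply translates \<open>F\<close>.
\<close>

definition homogeneous_sums :: "'g set \<Rightarrow> 'r set"
  where "homogeneous_sums F = {finsum R f F | f. f \<in> (\<Pi> k\<in>F. comp k)}"

lemma exists_homogeneous_sum:
  assumes "x \<in> carrier R"
  obtains F where "finite F" "F \<subseteq> carrier G" "x \<in> homogeneous_sums F"
proof -
  obtain f where f: "f \<in> (\<Pi>\<^sub>E g\<in>carrier G. comp g)"
      "finite {g \<in> carrier G. f g \<noteq> \<zero>\<^bsub>R\<^esub>}"
      "x = finsum R f {g \<in> carrier G. f g \<noteq> \<zero>\<^bsub>R\<^esub>}"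
    using ex1_implies_ex[OF direct_sum[OF assms]] by blast
  show thesis
  proof
    show "finite {g \<in> carrier G. f g \<noteq> \<zero>\<^bsub>R\<^esub>}" by fact
    show "{g \<in> carrier G. f g \<noteq> \<zero>\<^bsub>R\<^esub>} \<subseteq> carrier G" by blast
    show "x \<in> homogeneous_sums {g \<in> carrier G. f g \<noteq> \<zero>\<^bsub>R\<^esub>}"
      unfolding homogeneous_sums_def using f(1,3) by (auto simp: PiE_iff)
  qed
qed

lemma homogeneous_sums_shift:
  assumes h: "h \<in> carrier G" and r: "r \<in> comp h"
    and F: "finite F" "F \<subseteq> carrier G" and x: "x \<in> homogeneous_sums F"
  shows "r \<otimes>\<^bsub>R\<^esub> x \<in> homogeneous_sums ((\<lambda>k. h \<otimes>\<^bsub>G\<^esub> k) ` F)"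
proof -
  obtain f where f: "f \<in> (\<Pi> k\<in>F. comp k)" and x_eq: "x = finsum R f F"
    using x unfolding homogeneous_sums_def by blast
  define f' where "f' = (\<lambda>k. r \<otimes>\<^bsub>R\<^esub> f (inv\<^bsub>G\<^esub> h \<otimes>\<^bsub>G\<^esub> k))"
  have f'_shift: "f' (h \<otimes>\<^bsub>G\<^esub> k) = r \<otimes>\<^bsub>R\<^esub> f k" if "k \<in> F" for k
    using that h F(2) by (simp add: f'_def subsetD G.m_assoc[symmetric])
  have f_comp: "f k \<in> comp k" "f k \<in> carrier R" "k \<in> carrier G" if "k \<in> F" for k
    using that f F(2) comp_in_carrier by auto
  have f': "f' \<in> (\<Pi> k\<in>(\<lambda>k. h \<otimes>\<^bsub>G\<^esub> k) ` F. comp k)"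
    using f_comp h r by (auto simp: f'_shift comp_mult)
  have f'_carrier: "f' \<in> (\<lambda>k. h \<otimes>\<^bsub>G\<^esub> k) ` F \<rightarrow> carrier R"
    using f_comp comp_in_carrier[OF h r] by (auto simp: f'_shift)
  have inj: "inj_on (\<lambda>k. h \<otimes>\<^bsub>G\<^esub> k) F"
    using inj_on_subset[OF G.inj_on_cmult[OF h] F(2)] .
  have "r \<otimes>\<^bsub>R\<^esub> x = (\<Oplus>\<^bsub>R\<^esub>k\<in>F. r \<otimes>\<^bsub>R\<^esub> f k)"
    unfolding x_eq using F(1) comp_in_carrier[OF h r] f_comp
    by (intro R.finsum_rdistr) auto
  also have "\<dots> = (\<Oplus>\<^bsub>R\<^esub>k\<in>F. f' (h \<otimes>\<^bsub>G\<^esub> k))"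
    using f_comp comp_in_carrier[OF h r] by (intro R.finsum_cong') (auto simp: f'_shift)
  also have "\<dots> = finsum R f' ((\<lambda>k. h \<otimes>\<^bsub>G\<^esub> k) ` F)"
    using R.finsum_reindex[OF f'_carrier inj] by simp
  finally show ?thesis
    unfolding homogeneous_sums_def using f' by blast
qed

text \<open>
  Multiplying a homogeneous \<open>y\<close> by the neutral element \<open>a\<close> on either side preserves its degree,
  so the commutator can be formed term by term, and the term of degree \<open>e\<close> contributes zero.
\<close>

lemma commutator_drops_neutral:
  assumes comm: "\<And>a b. \<lbrakk>a \<in> comp \<one>\<^bsub>G\<^esub>; b \<in> comp \<one>\<^bsub>G\<^esub>\<rbrakk> \<Longrightarrow> a \<otimes>\<^bsub>R\<^esub> b = b \<otimes>\<^bsub>R\<^esub> a"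
    and a: "a \<in> comp \<one>\<^bsub>G\<^esub>"
    and F: "finite F" "F \<subseteq> carrier G" and x: "x \<in> homogeneous_sums F"
  shows "a \<otimes>\<^bsub>R\<^esub> x \<ominus>\<^bsub>R\<^esub> x \<otimes>\<^bsub>R\<^esub> a \<in> homogeneous_sums (F - {\<one>\<^bsub>G\<^esub>})"
proof -
  obtain f where f: "f \<in> (\<Pi> k\<in>F. comp k)" and x_eq: "x = finsum R f F"
    using x unfolding homogeneous_sums_def by blast
  have aR: "a \<in> carrier R"
    using a comp_in_carrier G.one_closed by blast
  have f_comp: "f k \<in> comp k" "f k \<in> carrier R" "k \<in> carrier G" if "k \<in> F" for k
    using that f F(2) comp_in_carrier by auto
  have xR: "x \<in> carrier R"
    unfolding x_eq using f_comp by (intro R.finsum_closed) auto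
  \<comment> \<open>Writing \<open>- x a\<close> as \<open>x (- a)\<close> turns the commutator into a sum of two products, over
    which \<open>finsum\<close> distributes.\<close>
  define c where "c = (\<lambda>k. a \<otimes>\<^bsub>R\<^esub> f k \<oplus>\<^bsub>R\<^esub> f k \<otimes>\<^bsub>R\<^esub> (\<ominus>\<^bsub>R\<^esub> a))"
  have neg_a: "\<ominus>\<^bsub>R\<^esub> a \<in> comp \<one>\<^bsub>G\<^esub>"
    using additive_subgroup.a_inv_closed[OF comp_additive_subgroup[OF G.one_closed] a] .
  have c_comp: "c k \<in> comp k" if "k \<in> F" for k
  proof -
    have "a \<otimes>\<^bsub>R\<^esub> f k \<in> comp k"
      using comp_mult[OF G.one_closed f_comp(3) a f_comp(1)] that f_comp(3) by simp
    moreover have "f k \<otimes>\<^bsub>R\<^esub> (\<ominus>\<^bsub>R\<^esub> a) \<in> comp k"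
      using comp_mult[OF f_comp(3) G.one_closed f_comp(1) neg_a] that f_comp(3) by simp
    ultimately show ?thesis
      unfolding c_def
      using additive_subgroup.a_closed[OF comp_additive_subgroup[OF f_comp(3)[OF that]]] by blast
  qed
  have c_one: "c \<one>\<^bsub>G\<^esub> = \<zero>\<^bsub>R\<^esub>" if "\<one>\<^bsub>G\<^esub> \<in> F"
    using f_comp(1,2)[OF that] comm[OF a] aR by (simp add: c_def R.r_minus R.r_neg)
  have "a \<otimes>\<^bsub>R\<^esub> x \<ominus>\<^bsub>R\<^esub> x \<otimes>\<^bsub>R\<^esub> a = a \<otimes>\<^bsub>R\<^esub> x \<oplus>\<^bsub>R\<^esub> x \<otimes>\<^bsub>R\<^esub> (\<ominus>\<^bsub>R\<^esub> a)"
    using aR xR by (simp add: R.r_minus R.minus_eq)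
  also have "\<dots> = (\<Oplus>\<^bsub>R\<^esub>k\<in>F. a \<otimes>\<^bsub>R\<^esub> f k) \<oplus>\<^bsub>R\<^esub> (\<Oplus>\<^bsub>R\<^esub>k\<in>F. f k \<otimes>\<^bsub>R\<^esub> (\<ominus>\<^bsub>R\<^esub> a))"
    unfolding x_eq using F(1) aR f_comp(2)
    by (simp add: R.finsum_rdistr R.finsum_ldistr Pi_def)
  also have "\<dots> = finsum R c F"
    unfolding c_def using aR f_comp(2) by (subst R.finsum_addf) auto
  also have "\<dots> = finsum R c (F - {\<one>\<^bsub>G\<^esub>})"
    using F c_one c_comp comp_in_carrier
    by (intro R.add.finprod_mono_neutral_cong_right) auto
  finally show ?thesis
    unfolding homogeneous_sums_def using c_comp by auto
qed

end

context strongly_graded_ring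
begin

text \<open>
  If \<open>x\<close> were annihilated by all of \<open>comp g\<close>, it would be annihilated by every sum of products
  from \<open>comp (inv g)\<close> and \<open>comp g\<close>, in particular by the unit.
\<close>

lemma exists_homogeneous_nonannihilator:
  assumes one: "\<one>\<^bsub>R\<^esub> \<in> comp \<one>\<^bsub>G\<^esub>" and g: "g \<in> carrier G"
    and x: "x \<in> carrier R" "x \<noteq> \<zero>\<^bsub>R\<^esub>"
  shows "\<exists>r\<in>comp g. r \<otimes>\<^bsub>R\<^esub> x \<noteq> \<zero>\<^bsub>R\<^esub>"
proof (rule ccontr)
  assume "\<not> ?thesis"
  then have kill: "\<And>r. r \<in> comp g \<Longrightarrow> r \<otimes>\<^bsub>R\<^esub> x = \<zero>\<^bsub>R\<^esub>"
    by blast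
  have "s \<in> carrier R \<and> s \<otimes>\<^bsub>R\<^esub> x = \<zero>\<^bsub>R\<^esub>" if "s \<in> ideal_prod R (comp (inv\<^bsub>G\<^esub> g)) (comp g)" for s
    using that
  proof induction
    case (prod i j)
    then have "i \<in> carrier R" "j \<in> carrier R"
      using comp_in_carrier[OF G.inv_closed[OF g]] comp_in_carrier[OF g] by auto
    with prod kill x(1) show ?case
      by (simp add: R.m_assoc)
  next
    case (sum s1 s2)
    with x(1) show ?case by (simp add: R.l_distr)
  qed
  moreover have "\<one>\<^bsub>R\<^esub> \<in> ideal_prod R (comp (inv\<^bsub>G\<^esub> g)) (comp g)"
    using one g by (simp add: strong)
  ultimately show False
    using x by force
qed

lemma nonzero_ideal_meets_neutral:
  assumes max_comm: "commutant R (comp \<one>\<^bsub>G\<^esub>) = comp \<one>\<^bsub>G\<^esub>"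
    and I: "ideal I R" "I \<noteq> {\<zero>\<^bsub>R\<^esub>}"
  obtains x where "x \<in> I" "x \<in> comp \<one>\<^bsub>G\<^esub>" "x \<noteq> \<zero>\<^bsub>R\<^esub>"
proof -
  interpret I: ideal I R by fact
  have comm: "a \<otimes>\<^bsub>R\<^esub> b = b \<otimes>\<^bsub>R\<^esub> a" if "a \<in> comp \<one>\<^bsub>G\<^esub>" "b \<in> comp \<one>\<^bsub>G\<^esub>" for a b
    using that max_comm unfolding commutant_def by blast
  have "\<one>\<^bsub>R\<^esub> \<in> commutant R (comp \<one>\<^bsub>G\<^esub>)"
    unfolding commutant_def using comp_in_carrier[OF G.one_closed] by auto
  then have one: "\<one>\<^bsub>R\<^esub> \<in> comp \<one>\<^bsub>G\<^esub>"
    using max_comm by simp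
  define P where "P = (\<lambda>F. finite F \<and> F \<subseteq> carrier G \<and> (\<exists>x\<in>I. x \<noteq> \<zero>\<^bsub>R\<^esub> \<and> x \<in> homogeneous_sums F))"
  obtain y where y: "y \<in> I" "y \<noteq> \<zero>\<^bsub>R\<^esub>"
    using I(2) I.zero_closed by blast
  obtain F0 where "finite F0" "F0 \<subseteq> carrier G" "y \<in> homogeneous_sums F0"
    using exists_homogeneous_sum[OF I.Icarr[OF y(1)]] .
  then have "P F0"
    unfolding P_def using y by blast
  then obtain F where "P F" and min: "\<And>F'. P F' \<Longrightarrow> card F \<le> card F'"
    using ex_has_least_nat[of P F0 card] by blast
  then obtain x where F: "finite F" "F \<subseteq> carrier G"
    and x: "x \<in> I" "x \<noteq> \<zero>\<^bsub>R\<^esub>" "x \<in> homogeneous_sums F"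
    unfolding P_def by blast
  have "F \<noteq> {}"
    using x(2,3) unfolding homogeneous_sums_def by auto
  then obtain g where g: "g \<in> F" "g \<in> carrier G"
    using F(2) by blast
  \<comment> \<open>Multiplying by an \<open>r\<close> of degree \<open>inv g\<close> moves the term of degree \<open>g\<close> to degree \<open>e\<close>.\<close>
  obtain r where r: "r \<in> comp (inv\<^bsub>G\<^esub> g)" "r \<otimes>\<^bsub>R\<^esub> x \<noteq> \<zero>\<^bsub>R\<^esub>"
    using exists_homogeneous_nonannihilator[OF one G.inv_closed[OF g(2)] I.Icarr[OF x(1)] x(2)] by blast
  define F' where "F' = (\<lambda>k. inv\<^bsub>G\<^esub> g \<otimes>\<^bsub>G\<^esub> k) ` F"
  define x' where "x' = r \<otimes>\<^bsub>R\<^esub> x"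
  have F': "finite F'" "F' \<subseteq> carrier G" "card F' \<le> card F"
    unfolding F'_def using F g(2) by (auto intro: card_image_le)
  have one_F': "\<one>\<^bsub>G\<^esub> \<in> F'"
    unfolding F'_def using g by (auto intro!: image_eqI[of _ _ g])
  have x': "x' \<in> I" "x' \<noteq> \<zero>\<^bsub>R\<^esub>" "x' \<in> homogeneous_sums F'"
    unfolding x'_def F'_def
    using I.I_l_closed[OF x(1)] comp_in_carrier[OF _ r(1)] r g(2) F x(3)
    by (auto intro: homogeneous_sums_shift)
  have x'R: "x' \<in> carrier R"
    using I.Icarr x'(1) .
  have "x' \<otimes>\<^bsub>R\<^esub> a = a \<otimes>\<^bsub>R\<^esub> x'" if a: "a \<in> comp \<one>\<^bsub>G\<^esub>" for a
  proof -
    have aR: "a \<in> carrier R"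
      using comp_in_carrier[OF G.one_closed a] .
    let ?c = "a \<otimes>\<^bsub>R\<^esub> x' \<ominus>\<^bsub>R\<^esub> x' \<otimes>\<^bsub>R\<^esub> a"
    have "?c \<in> I"
      using I.I_l_closed[OF x'(1) aR] I.I_r_closed[OF x'(1) aR]
      by (simp add: R.minus_eq I.a_closed I.a_inv_closed)
    moreover have "?c \<in> homogeneous_sums (F' - {\<one>\<^bsub>G\<^esub>})"
      using commutator_drops_neutral[OF comm a F'(1,2) x'(3)] .
    moreover have "\<not> P (F' - {\<one>\<^bsub>G\<^esub>})"
      using min[of "F' - {\<one>\<^bsub>G\<^esub>}"] F'(3) card_Diff1_less[OF F'(1) one_F'] by linarith
    ultimately have "?c = \<zero>\<^bsub>R\<^esub>"
      unfolding P_def using F'(1,2) by blast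
    then show ?thesis
      using aR x'R by simp
  qed
  then have "x' \<in> commutant R (comp \<one>\<^bsub>G\<^esub>)"
    unfolding commutant_def using x'R by blast
  with max_comm x'(1,2) that show thesis by blast
qed

end

theorem proposition1p6:
  fixes G :: "('g, 'm) monoid_scheme"
    and R :: "('r, 'n) ring_scheme"
    and comp :: "'g \<Rightarrow> 'r set"
  assumes "strongly_graded_ring G R comp"
    and "maximal_commutative R (comp \<one>\<^bsub>G\<^esub>)"
    and "simple_ring (R\<lparr>carrier := comp \<one>\<^bsub>G\<^esub>\<rparr>)"
  shows "simple_ring R"
proof -
  interpret strongly_graded_ring G R comp by fact
  let ?S = "R\<lparr>carrier := comp \<one>\<^bsub>G\<^esub>\<rparr>"
  have subcring: "subcring (comp \<one>\<^bsub>G\<^esub>) R" and max_comm: "commutant R (comp \<one>\<^bsub>G\<^esub>) = comp \<one>\<^bsub>G\<^esub>"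
    using assms(2) unfolding maximal_commutative_def by auto
  show ?thesis
  proof (unfold_locales, rule disjCI)
    fix I
    assume I: "ideal I R" and "I \<noteq> carrier R"
    show "I = {\<zero>\<^bsub>R\<^esub>}"
    proof (rule ccontr)
      assume "I \<noteq> {\<zero>\<^bsub>R\<^esub>}"
      then obtain x where "x \<in> I" "x \<in> comp \<one>\<^bsub>G\<^esub>" "x \<noteq> \<zero>\<^bsub>R\<^esub>"
        using nonzero_ideal_meets_neutral[OF max_comm I] by blast
      then have "I \<inter> comp \<one>\<^bsub>G\<^esub> \<noteq> {\<zero>\<^bsub>R\<^esub>}" by blast
      moreover have "ideal (I \<inter> comp \<one>\<^bsub>G\<^esub>) ?S"
        using R.ideal_Int_subring[OF I subcring.axioms(1)[OF subcring]] .
      ultimately have "I \<inter> comp \<one>\<^bsub>G\<^esub> = comp \<one>\<^bsub>G\<^esub>"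
        using simple_ring.ideal_trivial[OF assms(3)] by auto
      then have "\<one>\<^bsub>R\<^esub> \<in> I"
        using subcringE(3)[OF subcring] by blast
      then have "I = carrier R"
        using ideal.one_imp_carrier[OF I] by simp
      with \<open>I \<noteq> carrier R\<close> show False ..
    qed
  qed
qed

end
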